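(* Let $n\ge 2$ be an integer that is not a power of $2$. Then there is a vector $x_0\in\mathbf{R}^n$ with $\sum_{i=1}^n x_{0,i}=0$ such that, if $(x_k)_{k\ge0}$ is the repeated averaging chain on $\mathbf{R}^n$ started from $x_0$, then $x_k\ne0$ for all $k\ge0$ (whatever the realized choices of pairs).
   Context: Repeated averaging chain on $\mathbf{R}^n$: given $x_k=(x_{k,1},\ldots,x_{k,n})$, pick a pair of distinct indices $I,J\in\{1,\ldots,n\}$ uniformly at random (independently of the past), replace both $x_{k,I}$ and $x_{k,J}$ by $(x_{k,I}+x_{k,J})/2$, and keep all other coordinates the same; the result is $x_{k+1}$. Here $0$ denotes the zero vector of $\mathbf{R}^n$. *)

theory Defs
  imports "HOL-Analysis.Analysis" "HOL-Probability.Probability"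
begin

definition average_pair :: "'n::finite \<Rightarrow> 'n \<Rightarrow> real ^ 'n \<Rightarrow> real ^ 'n" where
  "average_pair I J x =
     (\<chi> i. if i = I \<or> i = J then (x $ I + x $ J) / 2 else x $ i)"

definition distinct_pairs :: "('n \<times> 'n) set" where
  "distinct_pairs = {(I, J). I \<noteq> J}"

(* The canonical probability space of the chain: the coordinates p 0, p 1, ... are independent
   and uniformly distributed on the ordered pairs of distinct indices. Its points are exactly
   the sequences of such pairs (uniform_count_measure A has space A), so quantifying over its
   space, rather than almost surely, means: whatever the realized choices. *)
definition pair_choices :: "(nat \<Rightarrow> 'n::finite \<times> 'n) measure" where
  "pair_choices = PiM UNIV (\<lambda>_. uniform_count_measure distinct_pairs)"

(* The state x_k as a random variable on pair_choices: x_{k+1} is obtained from x_k by averaging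
   the coordinates in the pair p k. *)
primrec averaging_chain ::
    "real ^ 'n::finite \<Rightarrow> nat \<Rightarrow> (nat \<Rightarrow> 'n \<times> 'n) \<Rightarrow> real ^ 'n" where
  "averaging_chain x0 0 p = x0"
| "averaging_chain x0 (Suc k) p =
     average_pair (fst (p k)) (snd (p k)) (averaging_chain x0 k p)"

lemma space_pair_choices:
  "p \<in> space pair_choices \<longleftrightarrow> (\<forall>k. fst (p k) \<noteq> snd (p k))"
  by (auto simp: pair_choices_def distinct_pairs_def space_PiM PiE_iff
      space_uniform_count_measure case_prod_beta)

lemma prob_space_pair_choices:
  assumes "CARD('n::finite) \<ge> 2"
  shows "prob_space (pair_choices :: (nat \<Rightarrow> 'n \<times> 'n) measure)"
proof -
  obtain a b :: 'n where "a \<noteq> b"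
    using assms by (metis card_2_iff' card_le_Suc0_iff_eq finite not_less_eq_eq numeral_2_eq_2 UNIV_I)
  then have "(distinct_pairs :: ('n \<times> 'n) set) \<noteq> {}"
    by (auto simp: distinct_pairs_def)
  then have "prob_space (uniform_count_measure (distinct_pairs :: ('n \<times> 'n) set))"
    by (intro prob_space_uniform_count_measure) auto
  then show ?thesis
    unfolding pair_choices_def by (intro prob_space_PiM)
qed

end

theory Submission
  imports Defs
begin

text \<open>
  Start from the vector all of whose entries are \<open>1\<close> except one, which is \<open>1 - n\<close>. Each state of
  the chain is then \<open>1 - n y\<close> with dyadic rational entries of \<open>y\<close>, since averaging
  preserves dyadic rationals. A zero entry would make \<open>1 / n\<close> dyadic, so \<open>n\<close> would divide a
  power of \<open>2\<close>.
\<close>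

text \<open>Averaging acts on \<open>1 - x\<close> exactly as on \<open>x\<close> and introduces at
  most one new factor 2 in the denominators, so \<open>2 ^ k\<close> clears them after
  \<open>k\<close> steps.\<close>

lemma averaging_chain_dyadic:
  fixes x0 :: "real ^ 'n::finite" and c :: real
  assumes "\<And>i. \<exists>a::int. 1 - x0 $ i = c * a"
  shows "\<exists>a::int. 2 ^ k * (1 - averaging_chain x0 k p $ i) = c * a"
proof (induction k arbitrary: i)
  case 0
  then show ?case using assms by simp
next
  case (Suc k)
  let ?x = "averaging_chain x0 k p"
  let ?I = "fst (p k)" and ?J = "snd (p k)"
  obtain a :: "'n \<Rightarrow> int" where a: "\<And>i. 2 ^ k * (1 - ?x $ i) = c * a i"
    using Suc.IH by metis
  show ?case
  proof (cases "i = ?I \<or> i = ?J")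
    case True
    then have "2 ^ Suc k * (1 - averaging_chain x0 (Suc k) p $ i)
        = 2 ^ k * (1 - ?x $ ?I) + 2 ^ k * (1 - ?x $ ?J)"
      by (simp add: average_pair_def field_simps)
    also have "\<dots> = c * of_int (a ?I + a ?J)"
      unfolding a by (simp add: distrib_left)
    finally show ?thesis by blast
  next
    case False
    then have "2 ^ Suc k * (1 - averaging_chain x0 (Suc k) p $ i) = 2 * (2 ^ k * (1 - ?x $ i))"
      by (simp add: average_pair_def)
    also have "\<dots> = c * of_int (2 * a i)"
      unfolding a by simp
    finally show ?thesis by blast
  qed
qed

theorem proposition2p13:
  assumes "CARD('n::finite) \<ge> 2"
    and "\<not> (\<exists>m::nat. CARD('n) = 2 ^ m)"
  shows "\<exists>x0 :: real ^ 'n. (\<Sum>i\<in>UNIV. x0 $ i) = 0 \<and>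
           (\<forall>p \<in> space pair_choices. \<forall>k. averaging_chain x0 k p \<noteq> 0)"
proof -
  fix j :: 'n
  define x0 :: "real ^ 'n" where "x0 = (\<chi> i. 1 - (if i = j then real CARD('n) else 0))"
  have sum: "(\<Sum>i\<in>UNIV. x0 $ i) = 0"
    by (simp add: x0_def sum_subtractf)
  \<comment> \<open>\<open>1 - x0\<close> is \<open>CARD('n)\<close> times the unit vector at
    \<open>j\<close>, which gives \<open>c = CARD('n)\<close>.\<close>
  have init: "\<exists>a::int. 1 - x0 $ i = real CARD('n) * a" for i
    by (rule exI[of _ "if i = j then 1 else 0"]) (simp add: x0_def)
  have "averaging_chain x0 k p \<noteq> 0" for k p
  proof
    assume "averaging_chain x0 k p = 0"
    \<comment> \<open>At the zero state \<open>1 - 0 = 1\<close>, so the left side of the invariant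
      is \<open>2 ^ k\<close> itself.\<close>
    then obtain a :: int where "2 ^ k = real CARD('n) * a"
      using averaging_chain_dyadic[of x0 _ k p j, OF init] by auto
    then have "real_of_int (2 ^ k) = real_of_int (int CARD('n) * a)"
      by simp
    then have "int (2 ^ k) = int CARD('n) * a"
      unfolding of_int_eq_iff by simp
    then have "CARD('n) dvd 2 ^ k"
      by (metis dvd_triv_left int_dvd_int_iff)
    \<comment> \<open>Since 2 is prime, every divisor of \<open>2 ^ k\<close> is a power of
      2.\<close>
    then show False
      using assms(2) divides_primepow_nat[of 2 "CARD('n)" k] by auto
  qed
  with sum show ?thesis by blast
qed

end
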